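(* For every input stream $I$ of the up-down run generation problem with buffer size $M$, there exists a proper algorithm whose output $S$ on $I$ satisfies $R(S)=\mathrm{OPT}(I)$.
   Context: Up-down run generation problem: an input stream $I$ of $N$ elements from a totally ordered set (duplicates allowed) is presented in order to an algorithm with a buffer (memory) of $M$ slots. The algorithm reads elements one by one from $I$ into the buffer and writes (ejects) elements from the buffer, appending them to an output sequence $S$; each written element frees its slot, which is then filled by the next input element, so the buffer is full except when fewer than $M$ unwritten elements remain. The algorithm chooses which buffered element to write next based on the buffer contents and the last element written (plus $o(M)$ words of internal state). A run is a sequence that is sorted (increasing) or reverse sorted (decreasing). $R(S)$ denotes the smallest $k$ such that $S$ is a concatenation $S_1\circ\cdots\circ S_k$ of runs. $\mathrm{OPT}(I)$ is the minimum of $R(S)$ over all possible output sequences of algorithms with buffer size $M$ on $I$ (the optimal offline number of runs). Time step $t$ means exactly $t$ elements have been written; $t$ is a decision point if $t=0$ or the algorithm finished a run at $t$ (and must then choose whether the next run is increasing or decreasing). A maximal increasing run is written as follows: start with the smallest element in the buffer, always write the smallest buffered element that is larger than the last element written, and end the run only when every element in the buffer is smaller than the last element written; a maximal decreasing run is defined symmetrically. A proper algorithm is one that always writes maximal runs. *)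

theory Defs
  imports "HOL-Library.Multiset"
begin

definition is_run :: "'a::linorder list \<Rightarrow> bool" where
  "is_run xs \<longleftrightarrow> sorted_wrt (\<le>) xs \<or> sorted_wrt (\<ge>) xs"

definition num_runs :: "'a::linorder list \<Rightarrow> nat" where
  "num_runs S = (LEAST k. \<exists>Ss. length Ss = k \<and> concat Ss = S \<and> (\<forall>xs\<in>set Ss. is_run xs))"

text \<open>A configuration consists of the buffer contents and the part of the input not yet read.\<close>

type_synonym 'a config = "'a multiset \<times> 'a list"

definition start :: "nat \<Rightarrow> 'a list \<Rightarrow> 'a config" where
  "start M I = (mset (take M I), drop M I)"

fun eject :: "'a \<Rightarrow> 'a config \<Rightarrow> 'a config" where
  "eject x (B, []) = (B - {#x#}, [])"
| "eject x (B, y # ys) = (add_mset y (B - {#x#}), ys)"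

text \<open>An algorithm maps its internal state, the buffer contents and the last element written
  (\<^term>\<open>None\<close> before the first write) to the element to write next and its new internal
  state.  The internal state is one natural number; no asymptotic bound on its size is imposed.\<close>

datatype 'a algorithm =
  Algorithm (init_state: nat) (next_write: "nat \<Rightarrow> 'a multiset \<Rightarrow> 'a option \<Rightarrow> 'a \<times> nat")

definition valid_algorithm :: "'a algorithm \<Rightarrow> bool" where
  "valid_algorithm A \<longleftrightarrow> (\<forall>s B l. B \<noteq> {#} \<longrightarrow> fst (next_write A s B l) \<in># B)"

primrec exec :: "'a algorithm \<Rightarrow> nat \<Rightarrow> nat \<Rightarrow> 'a option \<Rightarrow> 'a config \<Rightarrow> 'a list" where
  "exec A 0 s l c = []"
| "exec A (Suc n) s l c =
    (let (x, s') = next_write A s (fst c) l in x # exec A n s' (Some x) (eject x c))"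

text \<open>For a positive buffer size, the buffer becomes empty exactly after as many writes as there
  are input elements.\<close>

definition alg_output :: "nat \<Rightarrow> 'a algorithm \<Rightarrow> 'a list \<Rightarrow> 'a list" where
  "alg_output M A I = exec A (length I) (init_state A) None (start M I)"

text \<open>The algorithm attaining the minimum may depend on \<open>I\<close>: a counter in its state can index a
  hard-coded sequence of writes, so every output feasible with buffer size \<open>M\<close> is taken into account.\<close>

definition OPT :: "nat \<Rightarrow> 'a::linorder list \<Rightarrow> nat" where
  "OPT M I = (LEAST k. \<exists>A. valid_algorithm A \<and> k = num_runs (alg_output M A I))"

text \<open>The parameter \<open>le\<close> is \<open>(\<le>)\<close> for increasing and \<open>(\<ge>)\<close> for decreasing runs.  Runs are weakly
  monotone: an element equal to the last one written continues the run, and a run stops only when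
  every buffered element lies strictly on the wrong side of the last one written.
  \<open>continues_run le l c xs c'\<close> means that a maximal run whose last element written so far is \<open>l\<close>
  goes on from configuration \<open>c\<close> by writing \<open>xs\<close> and then stops in configuration \<open>c'\<close>.\<close>

inductive continues_run ::
    "('a \<Rightarrow> 'a \<Rightarrow> bool) \<Rightarrow> 'a \<Rightarrow> 'a config \<Rightarrow> 'a list \<Rightarrow> 'a config \<Rightarrow> bool"
  for le where
  stop: "(\<forall>y\<in>#fst c. \<not> le l y) \<Longrightarrow> continues_run le l c [] c"
| step: "x \<in># fst c \<Longrightarrow> le l x \<Longrightarrow> (\<forall>y\<in>#fst c. le l y \<longrightarrow> le x y) \<Longrightarrow>
    continues_run le x (eject x c) xs c' \<Longrightarrow> continues_run le l c (x # xs) c'"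

inductive maximal_run ::
    "('a \<Rightarrow> 'a \<Rightarrow> bool) \<Rightarrow> 'a config \<Rightarrow> 'a list \<Rightarrow> 'a config \<Rightarrow> bool"
  for le where
  "x \<in># fst c \<Longrightarrow> (\<forall>y\<in>#fst c. le x y) \<Longrightarrow> continues_run le x (eject x c) xs c' \<Longrightarrow>
    maximal_run le c (x # xs) c'"

inductive writes_maximal_runs :: "'a::linorder config \<Rightarrow> 'a list \<Rightarrow> bool" where
  finished: "fst c = {#} \<Longrightarrow> writes_maximal_runs c []"
| increasing: "maximal_run (\<le>) c xs c' \<Longrightarrow> writes_maximal_runs c' ys \<Longrightarrow>
    writes_maximal_runs c (xs @ ys)"
| decreasing: "maximal_run (\<ge>) c xs c' \<Longrightarrow> writes_maximal_runs c' ys \<Longrightarrow>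
    writes_maximal_runs c (xs @ ys)"

definition proper_algorithm :: "nat \<Rightarrow> 'a::linorder algorithm \<Rightarrow> bool" where
  "proper_algorithm M A \<longleftrightarrow> valid_algorithm A \<and>
    (\<forall>I. writes_maximal_runs (start M I) (alg_output M A I))"

end

theory Submission
  imports Defs
begin

text \<open>Cut an optimal output into its runs and let the proper algorithm write maximal runs in the same
  directions.  At every run boundary the elements written by the optimal algorithm form a
  sub-multiset of those written by the proper one: if \<open>v\<close> is the next element of an optimal run,
  then the maximal run, once it is about to pass \<open>v\<close>, has written everything the optimal algorithm
  wrote before \<open>v\<close>.  So it has read at least as much input, and any missing copy of \<open>v\<close> would be in its
  buffer and would be written first.\<close>

section \<open>Directions, extreme elements and decompositions into runs\<close>

text \<open>The direction is a boolean so that both kinds of run share one proof and a choice of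
  directions is a function into \<open>bool\<close>.\<close>

definition dir :: "bool \<Rightarrow> 'a::linorder \<Rightarrow> 'a \<Rightarrow> bool" where
  "dir up = (if up then (\<le>) else (\<ge>))"

lemma dir_refl [simp]: "dir up x x"
  by (simp add: dir_def)

lemma dir_trans: "dir up x y \<Longrightarrow> dir up y z \<Longrightarrow> dir up x z"
  by (auto simp: dir_def split: if_splits)

lemma is_run_iff_dir: "is_run xs \<longleftrightarrow> (\<exists>up. sorted_wrt (dir up) xs)"
  by (auto simp: is_run_def dir_def ex_bool_eq)

definition first_elem :: "bool \<Rightarrow> 'a::linorder multiset \<Rightarrow> 'a" where
  "first_elem up B = (if up then Min_mset B else Max_mset B)"

lemma first_elem_in: "B \<noteq> {#} \<Longrightarrow> first_elem up B \<in># B"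
  by (simp add: first_elem_def)

lemma first_elem_le: "y \<in># B \<Longrightarrow> dir up (first_elem up B) y"
  by (auto simp: first_elem_def dir_def)

lemma maximal_run_dir_writes:
  assumes "maximal_run (dir up) c xs c'" "writes_maximal_runs c' ys"
  shows "writes_maximal_runs c (xs @ ys)"
  using assms by (cases up) (auto simp: dir_def intro: writes_maximal_runs.intros)

lemma continues_run_sorted:
  "continues_run (dir up) l c xs c' \<Longrightarrow> sorted_wrt (dir up) (l # xs)"
  by (induction rule: continues_run.induct) (auto intro: dir_trans)

lemma maximal_run_sorted: "maximal_run (dir up) c xs c' \<Longrightarrow> sorted_wrt (dir up) xs"
  by (auto elim!: maximal_run.cases dest: continues_run_sorted)

lemma num_runs_le: "(\<And>xs. xs \<in> set Ss \<Longrightarrow> is_run xs) \<Longrightarrow> num_runs (concat Ss) \<le> length Ss"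
  unfolding num_runs_def by (rule Least_le) auto

lemma num_runs_decomposition:
  obtains Ss where "length Ss = num_runs S" "concat Ss = S" "\<And>xs. xs \<in> set Ss \<Longrightarrow> is_run xs"
proof -
  let ?P = "\<lambda>k. \<exists>Ss. length Ss = k \<and> concat Ss = S \<and> (\<forall>xs\<in>set Ss. is_run xs)"
  have "?P (length S)"
    \<comment> \<open>Singletons are runs, so some decomposition exists and the least length is
      attained.\<close>
    by (rule exI[of _ "map (\<lambda>x. [x]) S"]) (auto simp: is_run_def)
  then have "?P (num_runs S)"
    unfolding num_runs_def by (rule LeastI)
  with that show thesis by blast
qed

subsection \<open>Configurations determined by the written elements\<close>

context
  fixes M :: nat and I :: "'a::linorder list"
begin

text \<open>A configuration depends only on the multiset \<open>W\<close> of written elements, not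
  on their order: \<open>M + size W\<close> elements have been read, or all of \<open>I\<close> if
  it is shorter.\<close>

definition config_after :: "'a multiset \<Rightarrow> 'a config" where
  "config_after W = (mset (take (M + size W) I) - W, drop (M + size W) I)"

text \<open>This invariant makes the truncated multiset difference in \<open>config_after\<close>
  exact.\<close>

definition writable_set :: "'a multiset \<Rightarrow> bool" where
  "writable_set W \<longleftrightarrow> W \<subseteq># mset (take (M + size W) I)"

primrec writable :: "'a multiset \<Rightarrow> 'a list \<Rightarrow> bool" where
  "writable W [] \<longleftrightarrow> True"
| "writable W (x # xs) \<longleftrightarrow> x \<in># fst (config_after W) \<and> writable (add_mset x W) xs"

lemma config_after_empty: "config_after {#} = start M I"
  by (simp add: config_after_def start_def)

lemma writable_set_empty: "writable_set {#}"
  by (simp add: writable_set_def)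

lemma mset_take_mono: "m \<le> n \<Longrightarrow> mset (take m I) \<subseteq># mset (take n I)"
proof -
  assume "m \<le> n"
  then have "take n I = take m I @ take (n - m) (drop m I)"
    by (metis le_add_diff_inverse take_add)
  then show ?thesis by simp
qed

lemma writable_set_add:
  assumes "writable_set W" "x \<in># fst (config_after W)"
  shows "writable_set (add_mset x W)"
proof -
  have "add_mset x W \<subseteq># mset (take (M + size W) I)"
    using assms unfolding writable_set_def config_after_def
    by (metis fst_conv insert_union_subset_iff subset_mset.le_diff_conv2 add_mset_add_single
        add.commute single_subset_iff)
  also have "\<dots> \<subseteq># mset (take (M + size (add_mset x W)) I)"
    by (rule mset_take_mono) simp
  finally show ?thesis by (simp add: writable_set_def)
qed

lemma eject_config_after:
  assumes "writable_set W" "x \<in># fst (config_after W)"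
  shows "eject x (config_after W) = config_after (add_mset x W)"
proof (cases "drop (M + size W) I")
  case Nil
  then show ?thesis by (simp add: config_after_def)
next
  case (Cons y ys)
  then have "M + size W < length I"
    by (metis drop_all linorder_not_less list.distinct(1))
  then have "take (Suc (M + size W)) I = take (M + size W) I @ [y]"
    and "drop (Suc (M + size W)) I = ys"
    using Cons by (auto simp: take_Suc_conv_app_nth Cons_nth_drop_Suc[symmetric])
  \<comment> \<open>The truncated subtraction of \<open>add_mset x W\<close> is exact here, so the
    newly read \<open>y\<close> may be moved inside the difference.\<close>
  moreover have "add_mset x W \<subseteq># mset (take (M + size W) I)"
    using assms unfolding writable_set_def config_after_def
    by (metis fst_conv insert_union_subset_iff subset_mset.le_diff_conv2 add_mset_add_single
        add.commute single_subset_iff)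
  then have "add_mset y (mset (take (M + size W) I) - W - {#x#})
      = add_mset y (mset (take (M + size W) I)) - add_mset x W"
    by (metis add_mset_add_single diff_diff_add_mset subset_mset.add_diff_assoc2)
  ultimately show ?thesis
    using Cons by (simp add: config_after_def)
qed

text \<open>At least \<open>size W + 1\<close> elements have been read, so \<open>W\<close> cannot
  account for all of them.\<close>

lemma buffer_nonempty:
  assumes "M \<ge> 1" "writable_set W" "size W < length I"
  shows "fst (config_after W) \<noteq> {#}"
proof
  assume "fst (config_after W) = {#}"
  then have "mset (take (M + size W) I) \<subseteq># W"
    by (simp add: config_after_def Diff_eq_empty_iff_mset)
  then show False
    using assms size_mset_mono by fastforce
qed

lemma buffer_empty:
  assumes "writable_set W" "size W = length I"
  shows "fst (config_after W) = {#}"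
proof -
  have "W \<subseteq># mset I"
    using assms by (simp add: writable_set_def)
  then have "W = mset I"
    by (metis assms(2) mset_subset_size nat_neq_iff size_mset subset_mset.le_imp_less_or_eq)
  then show ?thesis by (simp add: config_after_def)
qed

lemma writable_append: "writable W (xs @ ys) \<longleftrightarrow> writable W xs \<and> writable (W + mset xs) ys"
  by (induction xs arbitrary: W) (auto simp: ac_simps)

lemma length_exec: "length (exec A n s l c) = n"
  by (induction n arbitrary: s l c) (auto simp: Let_def split: prod.split)

text \<open>Validity of \<open>A\<close> constrains only writes from a nonempty buffer; the bound on
  \<open>n\<close> keeps the buffer nonempty at every write.\<close>

lemma writable_exec:
  assumes "M \<ge> 1" "valid_algorithm A" "writable_set W" "size W + n \<le> length I"
  shows "writable W (exec A n s l (config_after W))"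
  using assms(3,4)
proof (induction n arbitrary: W s l)
  case (Suc n)
  obtain x s' where x: "next_write A s (fst (config_after W)) l = (x, s')"
    by fastforce
  have "fst (config_after W) \<noteq> {#}"
    using buffer_nonempty[OF assms(1)] Suc.prems by simp
  then have "x \<in># fst (config_after W)"
    using assms(2) x unfolding valid_algorithm_def by (metis fst_conv)
  then show ?case
    using Suc x by (simp add: eject_config_after writable_set_add)
qed simp

subsection \<open>Maximal runs dominate runs in the same direction\<close>

text \<open>The run always writes the nearest eligible element, so it can neither pass
  \<open>v\<close> nor stop while a copy of \<open>v\<close> is buffered. The
  \<open>takeWhile\<close> marks the moment just before it passes \<open>v\<close>.\<close>

lemma continues_run_exhausts:
  assumes "continues_run (dir up) l c zs c'" "c = config_after W" "writable_set W" "dir up l v"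
  shows "v \<notin># fst (config_after (W + mset (takeWhile (\<lambda>y. dir up y v) zs)))"
  using assms
proof (induction arbitrary: W rule: continues_run.induct)
  case (step x c l xs c')
  show ?case
  proof (cases "dir up x v")
    case True
    then show ?thesis
      using step.IH[of "add_mset x W"] step by (simp add: eject_config_after writable_set_add)
  qed (use step in auto)
qed auto

text \<open>A maximal run starts at the extreme element of its buffer, so a \<open>v\<close> lying
  strictly before that element is not buffered at all; every other \<open>v\<close> is covered by
  \<open>continues_run_exhausts\<close>.\<close>

lemma maximal_run_exhausts:
  assumes "maximal_run (dir up) (config_after W) zs c'" "writable_set W"
  shows "v \<notin># fst (config_after (W + mset (takeWhile (\<lambda>y. dir up y v) zs)))"
  using assms(1)
proof cases
  case (1 x xs)
  show ?thesis
  proof (cases "dir up x v")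
    case True
    then show ?thesis
      using continues_run_exhausts[OF 1(4), of "add_mset x W" v] 1 assms(2)
      by (simp add: eject_config_after writable_set_add)
  qed (use 1 in auto)
qed

text \<open>In a sorted list the elements not beyond \<open>v\<close> form a prefix, so cutting
  there loses no copy of such a \<open>u\<close>.\<close>

lemma sorted_takeWhile_count:
  assumes "sorted_wrt (dir up) zs" "dir up u v"
  shows "count (mset (takeWhile (\<lambda>y. dir up y v) zs)) u = count (mset zs) u"
  using assms
proof (induction zs)
  case (Cons z zs)
  then have "u \<notin> set (z # zs)" if "\<not> dir up z v"
    using that Cons.prems dir_trans[of up z u v] by auto
  with Cons show ?case
    by (auto simp: count_eq_zero_iff)
qed simp

text \<open>Induction from the end of \<open>xs\<close> exposes its last element \<open>v\<close>,
  the only one whose count grows. The two writers are compared at the moment when \<open>zs\<close>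
  is about to pass \<open>v\<close>.\<close>

lemma maximal_run_dominates:
  assumes run: "maximal_run (dir up) (config_after W) zs c'" and W: "writable_set W"
    and "V \<subseteq># W" "writable V xs" "sorted_wrt (dir up) xs"
  shows "V + mset xs \<subseteq># W + mset zs"
  using assms(3-)
proof (induction xs rule: rev_induct)
  case Nil
  then show ?case by (simp add: subset_mset.add_increasing2)
next
  case (snoc v xs)
  define p where "p = takeWhile (\<lambda>y. dir up y v) zs"
  let ?V = "V + mset xs"
  have IH: "?V \<subseteq># W + mset zs"
    using snoc by (simp add: writable_append sorted_wrt_append)
  have p_count: "count (mset p) u = count (mset zs) u" if "dir up u v" for u
    using sorted_takeWhile_count[OF maximal_run_sorted[OF run] that] by (simp add: p_def)
  \<comment> \<open>Up to \<open>v\<close>, the prefix \<open>p\<close> has the same counts as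
    \<open>zs\<close>. An element beyond \<open>v\<close> cannot occur in \<open>xs\<close>, which
    precedes \<open>v\<close>, so \<open>V \<subseteq># W\<close> covers it.\<close>
  have sub: "?V \<subseteq># W + mset p"
  proof (rule mset_subset_eqI)
    fix u
    show "count ?V u \<le> count (W + mset p) u"
    proof (cases "dir up u v")
      case True
      then show ?thesis
        using mset_subset_eq_count[OF IH, of u] p_count by simp
    next
      case False
      then have "u \<notin> set xs"
        using snoc.prems by (auto simp: sorted_wrt_append)
      then show ?thesis
        using mset_subset_eq_count[OF snoc.prems(1), of u] by (simp add: trans_le_add1 flip: count_mset_0_iff)
    qed
  qed
  \<comment> \<open>On the side of \<open>V\<close> a copy of \<open>v\<close> is read but
    unwritten. The other side has read at least as much and, after \<open>p\<close>, has written
    every copy of \<open>v\<close> it has read, so its count of \<open>v\<close> is strictly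
    larger.\<close>
  have "v \<in># mset (take (M + size ?V) I) - ?V"
    using snoc.prems by (simp add: writable_append config_after_def)
  then have "count ?V v < count (mset (take (M + size ?V) I)) v"
    by (simp only: in_diff_count)
  also have "\<dots> \<le> count (mset (take (M + size (W + mset p)) I)) v"
    by (intro mset_subset_eq_count mset_take_mono add_left_mono size_mset_mono sub)
  also have "\<dots> \<le> count (W + mset p) v"
    using maximal_run_exhausts[OF run W, of v] unfolding p_def[symmetric]
    by (simp add: config_after_def in_diff_count not_less)
  also have "\<dots> = count (W + mset zs) v"
    by (simp add: p_count)
  finally have "count ?V v < count (W + mset zs) v" .
  then show ?case
    using IH by (auto simp: subseteq_mset_def Suc_le_eq)
qed

end

subsection \<open>The proper algorithm following a sequence of directions\<close>

text \<open>The state is the index of the current run, and \<open>d k\<close> tells whether run \<open>k\<close> is increasing.\<close>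

definition follow :: "(nat \<Rightarrow> bool) \<Rightarrow> 'a::linorder algorithm" where
  "follow d = Algorithm 0 (\<lambda>k B l. case l of
      None \<Rightarrow> (first_elem (d k) B, k)
    | Some l \<Rightarrow>
        let C = filter_mset (dir (d k) l) B in
        if C \<noteq> {#} then (first_elem (d k) C, k) else (first_elem (d (Suc k)) B, Suc k))"

lemma init_state_follow [simp]: "init_state (follow d) = 0"
  by (simp add: follow_def)

lemma next_write_follow:
  "next_write (follow d) k B None = (first_elem (d k) B, k)"
  "filter_mset (dir (d k) l) B \<noteq> {#} \<Longrightarrow>
    next_write (follow d) k B (Some l) = (first_elem (d k) (filter_mset (dir (d k) l) B), k)"
  "filter_mset (dir (d k) l) B = {#} \<Longrightarrow>
    next_write (follow d) k B (Some l) = (first_elem (d (Suc k)) B, Suc k)"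
  by (simp_all add: follow_def Let_def)

lemma valid_follow: "valid_algorithm (follow d)"
proof -
  have "first_elem up (filter_mset P B) \<in># B" if "filter_mset P B \<noteq> {#}"
    for up and P :: "'a \<Rightarrow> bool" and B
    using first_elem_in[OF that] by simp
  then show ?thesis
    by (auto simp: valid_algorithm_def follow_def Let_def first_elem_in split: option.split)
qed

text \<open>The end of a run is expressed by switching to \<open>None\<close> and
  \<open>Suc k\<close>, so that the remaining output is a fresh start from the configuration
  reached.\<close>

lemma exec_follow_continue:
  assumes "M \<ge> 1" "writable_set M I W" "size W + n = length I"
  shows "\<exists>xs n'. continues_run (dir (d k)) l (config_after M I W) xs (config_after M I (W + mset xs)) \<and>
    writable_set M I (W + mset xs) \<and> size (W + mset xs) + n' = length I \<and>
    exec (follow d) n k (Some l) (config_after M I W)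
      = xs @ exec (follow d) n' (Suc k) None (config_after M I (W + mset xs))"
  using assms(2,3)
proof (induction n arbitrary: W l)
  case 0
  then have "fst (config_after M I W) = {#}"
    using buffer_empty by auto
  then show ?case
    using 0 by (intro exI[of _ "[]"] exI[of _ 0]) (auto intro: continues_run.stop)
next
  case (Suc n)
  let ?B = "fst (config_after M I W)"
  let ?C = "filter_mset (dir (d k) l) ?B"
  show ?case
  proof (cases "?C = {#}")
    case True
    then have "\<forall>y\<in>#?B. \<not> dir (d k) l y"
      by auto
    \<comment> \<open>With no eligible element, the next write after \<open>l\<close> in state
      \<open>k\<close> and the state it leaves agree with those of a first write in state
      \<open>Suc k\<close>.\<close>
    then show ?thesis
      using Suc.prems True
      by (intro exI[of _ "[]"] exI[of _ "Suc n"]) (auto intro: continues_run.stop simp: next_write_follow)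
  next
    case False
    define x where "x = first_elem (d k) ?C"
    have "x \<in># ?C"
      unfolding x_def using False by (rule first_elem_in)
    then have x: "x \<in># ?B" "dir (d k) l x"
      by auto
    have x_le: "dir (d k) x y" if "y \<in># ?B" "dir (d k) l y" for y
      using first_elem_le[of y ?C "d k"] that by (simp add: x_def)
    have W': "writable_set M I (add_mset x W)" "size (add_mset x W) + n = length I"
      using Suc.prems x by (auto intro: writable_set_add)
    have ej: "eject x (config_after M I W) = config_after M I (add_mset x W)"
      using Suc.prems x by (intro eject_config_after)
    obtain xs n' where xs:
      "continues_run (dir (d k)) x (config_after M I (add_mset x W)) xs
        (config_after M I (add_mset x W + mset xs))"
      "writable_set M I (add_mset x W + mset xs)"
      "size (add_mset x W + mset xs) + n' = length I"
      "exec (follow d) n k (Some x) (config_after M I (add_mset x W))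
        = xs @ exec (follow d) n' (Suc k) None (config_after M I (add_mset x W + mset xs))"
      using Suc.IH[OF W'] by blast
    have "exec (follow d) (Suc n) k (Some l) (config_after M I W)
        = x # exec (follow d) n k (Some x) (config_after M I (add_mset x W))"
      using False by (simp add: next_write_follow ej flip: x_def)
    moreover have "continues_run (dir (d k)) l (config_after M I W) (x # xs)
        (config_after M I (add_mset x W + mset xs))"
      using x x_le xs(1) ej by (intro continues_run.step) auto
    ultimately show ?thesis
      using xs by (intro exI[of _ "x # xs"] exI[of _ n']) simp
  qed
qed

text \<open>Splits off one whole run; \<open>n' < n\<close> drives the strong induction for
  properness, since runs have no fixed length.\<close>

lemma exec_follow_run:
  assumes "M \<ge> 1" "writable_set M I W" "size W + n = length I" "n > 0"
  obtains zs n' where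
    "maximal_run (dir (d k)) (config_after M I W) zs (config_after M I (W + mset zs))"
    "writable_set M I (W + mset zs)" "size (W + mset zs) + n' = length I" "n' < n"
    "exec (follow d) n k None (config_after M I W)
      = zs @ exec (follow d) n' (Suc k) None (config_after M I (W + mset zs))"
proof -
  let ?B = "fst (config_after M I W)"
  obtain m where n: "n = Suc m"
    using assms(4) gr0_implies_Suc by blast
  define x where "x = first_elem (d k) ?B"
  have "?B \<noteq> {#}"
    using buffer_nonempty assms by fastforce
  then have x: "x \<in># ?B"
    by (simp add: x_def first_elem_in)
  have ej: "eject x (config_after M I W) = config_after M I (add_mset x W)"
    using assms x by (intro eject_config_after)
  have "writable_set M I (add_mset x W)" "size (add_mset x W) + m = length I"
    using assms x n by (auto intro: writable_set_add)
  from exec_follow_continue[OF assms(1) this, of d k x] obtain xs n' where xs: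
    "continues_run (dir (d k)) x (config_after M I (add_mset x W)) xs
      (config_after M I (add_mset x W + mset xs))"
    "writable_set M I (add_mset x W + mset xs)"
    "size (add_mset x W + mset xs) + n' = length I"
    "exec (follow d) m k (Some x) (config_after M I (add_mset x W))
      = xs @ exec (follow d) n' (Suc k) None (config_after M I (add_mset x W + mset xs))"
    by blast
  show thesis
  proof (rule that[of "x # xs" n'])
    show "maximal_run (dir (d k)) (config_after M I W) (x # xs) (config_after M I (W + mset (x # xs)))"
      using x xs(1) ej by (intro maximal_run.intros) (auto simp: x_def first_elem_le)
    have "exec (follow d) n k None (config_after M I W)
        = x # exec (follow d) m k (Some x) (config_after M I (add_mset x W))"
      by (simp add: n next_write_follow ej flip: x_def)
    then show "exec (follow d) n k None (config_after M I W)
        = (x # xs) @ exec (follow d) n' (Suc k) None (config_after M I (W + mset (x # xs)))"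
      using xs(4) by simp
  qed (use xs assms in auto)
qed

lemma writes_maximal_runs_follow:
  assumes "M \<ge> 1" "writable_set M I W" "size W + n = length I"
  shows "writes_maximal_runs (config_after M I W) (exec (follow d) n k None (config_after M I W))"
  using assms(2,3)
proof (induction n arbitrary: W k rule: less_induct)
  case (less n)
  show ?case
  proof (cases "n = 0")
    case True
    then show ?thesis
      using less.prems buffer_empty by (auto intro: writes_maximal_runs.finished)
  next
    case False
    then show ?thesis
      using exec_follow_run[OF assms(1) less.prems, of d k] less.IH maximal_run_dir_writes
      by (metis neq0_conv)
  qed
qed

lemma proper_follow: "M \<ge> 1 \<Longrightarrow> proper_algorithm M (follow d)"
  by (auto simp: proper_algorithm_def valid_follow alg_output_def config_after_empty[symmetric]
      intro!: writes_maximal_runs_follow writable_set_empty)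

section \<open>Comparison with an arbitrary valid algorithm\<close>

text \<open>The invariant \<open>V \<subseteq># W\<close> at run boundaries is preserved by
  \<open>maximal_run_dominates\<close>, and each run of \<open>Ss\<close> is matched by at most one
  run of \<open>Ts\<close>.\<close>

lemma follow_runs:
  assumes "M \<ge> 1" "writable_set M I W" "size W + n = length I" "V \<subseteq># W"
    "writable M I V (concat Ss)" "size V + length (concat Ss) = length I"
    "\<And>i. i < length Ss \<Longrightarrow> sorted_wrt (dir (d (k + i))) (Ss ! i)"
  shows "\<exists>Ts. concat Ts = exec (follow d) n k None (config_after M I W) \<and>
    length Ts \<le> length Ss \<and> (\<forall>xs\<in>set Ts. is_run xs)"
  using assms(2-)
proof (induction Ss arbitrary: W V n k)
  case Nil
  \<comment> \<open>With no runs left \<open>V\<close> has size \<open>length I\<close>, so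
    \<open>W\<close>, which contains it, is complete too.\<close>
  then have "n = 0"
    using size_mset_mono[OF Nil.prems(3)] by simp
  then show ?case by simp
next
  case (Cons S Ss)
  show ?case
  proof (cases "n = 0")
    case True
    \<comment> \<open>The proper algorithm may finish early, which only makes \<open>Ts\<close>
      shorter.\<close>
    then show ?thesis by (intro exI[of _ "[]"]) simp
  next
    case False
    then obtain zs n' where zs:
      "maximal_run (dir (d k)) (config_after M I W) zs (config_after M I (W + mset zs))"
      "writable_set M I (W + mset zs)" "size (W + mset zs) + n' = length I"
      "exec (follow d) n k None (config_after M I W)
        = zs @ exec (follow d) n' (Suc k) None (config_after M I (W + mset zs))"
      using exec_follow_run[OF assms(1) Cons.prems(1,2), of d k] by blast
    have "sorted_wrt (dir (d k)) S"
      using Cons.prems(6)[of 0] by simp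
    then have "V + mset S \<subseteq># W + mset zs"
      using Cons.prems by (intro maximal_run_dominates[OF zs(1)]) (auto simp: writable_append)
    moreover have "sorted_wrt (dir (d (Suc k + i))) (Ss ! i)" if "i < length Ss" for i
      using Cons.prems(6)[of "Suc i"] that by simp
    ultimately obtain Ts where
      "concat Ts = exec (follow d) n' (Suc k) None (config_after M I (W + mset zs))"
      "length Ts \<le> length Ss" "\<forall>xs\<in>set Ts. is_run xs"
      using Cons.IH[OF zs(2,3), of "V + mset S" "Suc k"] Cons.prems(4,5)
      by (auto simp: writable_append)
    then show ?thesis
      using zs(4) maximal_run_sorted[OF zs(1)]
      by (intro exI[of _ "zs # Ts"]) (auto simp: is_run_iff_dir)
  qed
qed

lemma follow_le_algorithm:
  assumes "M \<ge> 1" "valid_algorithm A"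
  shows "\<exists>d. num_runs (alg_output M (follow d) I) \<le> num_runs (alg_output M A I)"
proof -
  obtain Ss where Ss: "length Ss = num_runs (alg_output M A I)" "concat Ss = alg_output M A I"
    "\<And>xs. xs \<in> set Ss \<Longrightarrow> is_run xs"
    using num_runs_decomposition by blast
  \<comment> \<open>The guard \<open>i < length Ss\<close> under the existential lets choice yield a
    total \<open>d\<close>; a run sorted both ways may receive either direction.\<close>
  have "\<forall>i. \<exists>up. i < length Ss \<longrightarrow> sorted_wrt (dir up) (Ss ! i)"
    using Ss(3) by (auto simp: is_run_iff_dir)
  then obtain d where "\<And>i. i < length Ss \<Longrightarrow> sorted_wrt (dir (d i)) (Ss ! i)"
    by metis
  moreover have "writable M I {#} (concat Ss)"
    using writable_exec[OF assms writable_set_empty[of M I]]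
    by (simp add: Ss(2) alg_output_def config_after_empty)
  ultimately obtain Ts where "concat Ts = alg_output M (follow d) I" "length Ts \<le> length Ss"
    "\<forall>xs\<in>set Ts. is_run xs"
    using follow_runs[OF assms(1) writable_set_empty, of "length I" I "{#}" Ss d 0]
    by (auto simp: Ss(2) alg_output_def length_exec config_after_empty)
  then show ?thesis
    using num_runs_le[of Ts] Ss(1) by (metis order_trans)
qed

theorem theorem1:
  fixes I :: "'a::linorder list" and M :: nat
  assumes "M \<ge> 1"
  shows "\<exists>A. proper_algorithm M A \<and> num_runs (alg_output M A I) = OPT M I"
proof -
  let ?P = "\<lambda>k. \<exists>A. valid_algorithm A \<and> k = num_runs (alg_output M A I)"
  \<comment> \<open>Some valid algorithm must exist for the minimum in \<open>OPT\<close> to be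
    attained; always going up provides one.\<close>
  have "?P (num_runs (alg_output M (follow (\<lambda>_. True)) I))"
    using valid_follow by blast
  then have "?P (OPT M I)"
    unfolding OPT_def by (rule LeastI)
  then obtain A where A: "valid_algorithm A" "OPT M I = num_runs (alg_output M A I)"
    by blast
  \<comment> \<open>The directions \<open>d\<close> depend on \<open>I\<close>, yet
    \<open>follow d\<close> is proper on every input.\<close>
  obtain d where "num_runs (alg_output M (follow d) I) \<le> OPT M I"
    using follow_le_algorithm[OF assms A(1)] A(2) by metis
  moreover have "OPT M I \<le> num_runs (alg_output M (follow d) I)"
    unfolding OPT_def using valid_follow by (intro Least_le) blast
  ultimately show ?thesis
    using proper_follow[OF assms] by (metis le_antisym)
qed

end
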